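(* Let $\Omega$ be a domain in $\mathbb{R}^{m+n}$, $m,n\geq 2$, and let $K_1,K_2\geq 1$. Let $u:\Omega\to[-\infty,+\infty)$ be a Lebesgue measurable function such that (a) for each $y\in\mathbb{R}^n$ the function $\Omega(y)\ni x\mapsto u(x,y)\in[-\infty,+\infty)$ is $K_1$-quasi-nearly subharmonic, (b) for almost every $x\in\mathbb{R}^m$ the function $\Omega(x)\ni y\mapsto u(x,y)\in[-\infty,+\infty)$ is $K_2$-quasi-nearly subharmonic, (c) there exists a non-constant permissible function $\psi:[0,+\infty)\to[0,+\infty)$ such that $\psi\circ u^+\in\mathcal{L}^1_{\mathrm{loc}}(\Omega)$. Then $u$ is $\frac{4^{m+n}\nu_{m+n}K_1K_2}{\nu_m\,\nu_n}$-quasi-nearly subharmonic in $\Omega$.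
   Context: Points of $\mathbb{R}^{m+n}$ are written $(x,y)$ with $x\in\mathbb{R}^m$, $y\in\mathbb{R}^n$. For $\Omega\subset\mathbb{R}^{m+n}$ put $\Omega(y)=\{x\in\mathbb{R}^m:(x,y)\in\Omega\}$ and $\Omega(x)=\{y\in\mathbb{R}^n:(x,y)\in\Omega\}$ (open, possibly empty or disconnected; definitions below are applied verbatim on them). $m_N$ is Lebesgue measure on $\mathbb{R}^N$, $B^N(x,r)$ the open ball, $\nu_N=m_N(B^N(0,1))$, and $u^+=\max\{u,0\}$. Let $D\subset\mathbb{R}^N$ be open, $N\ge2$, and $K\geq1$. A Lebesgue measurable function $u:D\to[-\infty,+\infty)$ is $K$-quasi-nearly subharmonic if $u^+\in\mathcal{L}^1_{\mathrm{loc}}(D)$ and for all $M\geq 0$ and all closed balls $\overline{B^N(x,r)}\subset D$, $$u_M(x)\leq\frac{K}{\nu_N r^N}\int_{B^N(x,r)}u_M(y)\,dm_N(y),\qquad u_M:=\max\{u,-M\}+M.$$ A function $\varphi:[0,+\infty)\to[0,+\infty)$ satisfies the $\Delta_2$-condition if there is a constant $C\geq1$ with $\varphi(2t)\leq C\varphi(t)$ for all $t\geq0$. A function $\psi:[0,+\infty)\to[0,+\infty)$ is permissible if there exist an increasing (strictly or not), convex function $\psi_1:[0,+\infty)\to[0,+\infty)$ and a strictly increasing surjection $\psi_2:[0,+\infty)\to[0,+\infty)$ such that $\psi=\psi_2\circ\psi_1$, $\psi_1$ satisfies the $\Delta_2$-condition, $\psi_2^{-1}$ satisfies the $\Delta_2$-condition,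 and $t\mapsto\psi_2(t)/t$ is quasi-decreasing, i.e. there is $C>0$ with $\psi_2(s)/s\geq C\,\psi_2(t)/t$ for all $0<s\leq t$. *)

theory Defs
  imports "HOL-Analysis.Analysis"
begin

definition locally_integrable_on :: "('a::euclidean_space \<Rightarrow> real) \<Rightarrow> 'a set \<Rightarrow> bool"
    (infix "locally'_integrable'_on" 46) where
  "f locally_integrable_on D \<longleftrightarrow> (\<forall>C. compact C \<and> C \<subseteq> D \<longrightarrow> f absolutely_integrable_on C)"

text \<open>
  Functions with values in \<open>[-\<infinity>, \<infinity>)\<close> are \<^typ>\<open>ereal\<close>-valued functions that avoid \<open>\<infinity>\<close> on
  their domain. For such values the positive part and the truncation \<open>max t (-M) + M\<close> are finite,
  so the conversions to \<^typ>\<open>real\<close> below lose nothing.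
\<close>

definition pos_part :: "ereal \<Rightarrow> real" where
  "pos_part t = real_of_ereal (max t 0)"

definition truncate_below :: "real \<Rightarrow> ereal \<Rightarrow> real" where
  "truncate_below M t = real_of_ereal (max t (ereal (- M)) + ereal M)"

text \<open>
  The local integrability of the positive part makes every truncation integrable on the balls in
  question, so the Bochner integral below never takes its default value \<open>0\<close>.
\<close>

definition quasi_nearly_subharmonic_on ::
    "real \<Rightarrow> ('a::euclidean_space \<Rightarrow> ereal) \<Rightarrow> 'a set \<Rightarrow> bool" where
  "quasi_nearly_subharmonic_on K u D \<longleftrightarrow>
     2 \<le> DIM('a) \<and> open D \<and> 1 \<le> K \<and>
     (\<forall>x\<in>D. u x < \<infinity>) \<and>
     u \<in> borel_measurable (lebesgue_on D) \<and>
     (\<lambda>x. pos_part (u x)) locally_integrable_on D \<and>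
     (\<forall>M\<ge>0. \<forall>x r. 0 < r \<and> cball x r \<subseteq> D \<longrightarrow>
        truncate_below M (u x)
          \<le> K / (measure lebesgue (ball (0::'a) 1) * r ^ DIM('a)) *
             (LINT y:ball x r|lebesgue. truncate_below M (u y)))"

text \<open>
  Functions \<open>[0, \<infinity>) \<rightarrow> [0, \<infinity>)\<close> are functions \<^typ>\<open>real \<Rightarrow> real\<close> of which only the restriction to
  \<^term>\<open>{0::real..}\<close> matters.
\<close>

definition delta2_condition :: "(real \<Rightarrow> real) \<Rightarrow> bool" where
  "delta2_condition \<phi> \<longleftrightarrow> (\<exists>C\<ge>1. \<forall>t\<ge>0. \<phi> (2 * t) \<le> C * \<phi> t)"

definition permissible :: "(real \<Rightarrow> real) \<Rightarrow> bool" where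
  "permissible \<psi> \<longleftrightarrow>
     (\<exists>\<psi>\<^sub>1 \<psi>\<^sub>2.
        \<psi>\<^sub>1 ` {0..} \<subseteq> {0..} \<and> mono_on {0..} \<psi>\<^sub>1 \<and> convex_on {0..} \<psi>\<^sub>1 \<and>
        \<psi>\<^sub>2 ` {0..} = {0..} \<and> strict_mono_on {0..} \<psi>\<^sub>2 \<and>
        (\<forall>t\<ge>0. \<psi> t = \<psi>\<^sub>2 (\<psi>\<^sub>1 t)) \<and>
        delta2_condition \<psi>\<^sub>1 \<and>
        delta2_condition (inv_into {0..} \<psi>\<^sub>2) \<and>
        (\<exists>C>0. \<forall>s t. 0 < s \<and> s \<le> t \<longrightarrow> C * (\<psi>\<^sub>2 t / t) \<le> \<psi>\<^sub>2 s / s))"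

end

theory Submission
  imports Defs
begin

text \<open>
  Once \<open>u\<^sup>+\<close> is known to be locally integrable, the mean value inequality is immediate: for \<open>M \<ge> 0\<close> the
  inequality in \<open>x\<close> over a ball of radius \<open>r / 2\<close>, followed by the one in \<open>y\<close> for almost every \<open>x\<close>,
  bounds the truncation \<open>u\<^sub>M\<close> at \<open>(a, b)\<close> by a constant times its integral over the product of two
  balls, which lies in the ball of radius \<open>r\<close> around \<open>(a, b)\<close>
  (\<open>separately_mean_bounded_le\<close>, with Tonelli's theorem in the form \<open>iterated_mean_le\<close>).

  The integrability of \<open>u\<^sup>+\<close> is the real content. In fact \<open>v = u\<^sup>+\<close> is locally bounded. A permissible
  \<open>\<psi>\<close> that is not constant has an increasing minorant \<open>\<phi> \<ge> 0\<close>, not identically zero, with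
  \<open>2 * \<phi> t \<le> \<phi> (A * t)\<close> for some \<open>A \<ge> 2\<close> (\<open>permissible_minorant\<close>); in particular \<open>\<phi>\<close> is unbounded.
  For a function \<open>v\<close> of one vector variable in dimension \<open>N\<close> that is bounded by \<open>K\<close> times its averages
  over balls, \<open>\<phi> (v z / (2 * K))\<close> is bounded by a constant times the average of \<open>\<phi> \<circ> v\<close>
  (\<open>mean_bounded_compose\<close>): where \<open>v\<close> is not much larger than \<open>v z\<close>, it is comparable to \<open>v z\<close> on a
  definite proportion of the ball (\<open>superlevel_set_large\<close>); otherwise one moves to a point where \<open>v\<close> is
  larger by the factor \<open>A ^ N\<close> and halves the radius. The growth of \<open>\<phi>\<close> pays for the loss of volume,
  and the process ends because \<open>v\<close> is locally bounded. The constant does not depend on the slice.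
  Applying this in \<open>x\<close> and then in \<open>y\<close> bounds \<open>\<phi> (v / (4 * K\<^sub>1 * K\<^sub>2))\<close> by a constant times a local
  integral of \<open>\<psi> \<circ> v\<close>, hence bounds \<open>v\<close> (\<open>separately_mean_bounded_locally_bounded\<close>).
\<close>

section \<open>Volumes of balls and locally integrable functions\<close>

lemma measure_ball_scale:
  fixes z w :: "'a::euclidean_space"
  assumes "0 < r"
  shows "measure lebesgue (ball z r) = measure lebesgue (ball w 1) * r ^ DIM('a)"
  using content_ball_conv_unit_ball[of r z] content_ball_conv_unit_ball[of 1 w] assms
  by simp

lemma measure_ball_translate:
  fixes z w :: "'a::euclidean_space"
  assumes "0 < r"
  shows "measure lebesgue (ball z r) = measure lebesgue (ball w r)"
  using measure_ball_scale[OF assms] by metis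

lemma measure_ball_pos:
  fixes z :: "'a::euclidean_space"
  assumes "0 < r"
  shows "0 < measure lebesgue (ball z r)"
  using content_ball_pos[OF assms, of z] by simp

lemma emeasure_ball_eq:
  fixes z :: "'a::euclidean_space"
  shows "emeasure lebesgue (ball z r) = ennreal (measure lebesgue (ball z r))"
  using emeasure_lborel_ball_finite[of z r] by (intro emeasure_eq_ennreal_measure) auto

text \<open>
  No integrability is needed: the Bochner integral of a non-integrable function is \<open>0\<close>. This lets the
  mean value inequality of a slice be read in \<^typ>\<open>ennreal\<close> before anything is known about the
  integrability of its right-hand side.
\<close>

lemma integral_le_nn_integral:
  assumes "AE x in M. (0::real) \<le> f x"
  shows "ennreal (integral\<^sup>L M f) \<le> (\<integral>\<^sup>+x. ennreal (f x) \<partial>M)"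
proof (cases "integrable M f")
  case True
  then show ?thesis by (simp add: nn_integral_eq_integral[OF _ assms])
next
  case False
  then show ?thesis by (simp add: not_integrable_integral_eq)
qed

lemma locally_integrable_measurable:
  assumes "v locally_integrable_on D" "compact C" "C \<subseteq> D" "B \<subseteq> C"
  shows "v \<in> borel_measurable (lebesgue_on B)"
proof -
  have "v absolutely_integrable_on C" using assms unfolding locally_integrable_on_def by blast
  then have "v \<in> borel_measurable (lebesgue_on C)"
    using absolutely_integrable_measurable assms(2) by (metis lmeasurable_compact fmeasurableD)
  then show ?thesis using assms(4) by (rule measurable_restrict_mono)
qed

lemma locally_integrable_nn_integral_finite:
  assumes "v locally_integrable_on D" "compact C" "C \<subseteq> D"
  shows "(\<integral>\<^sup>+x\<in>C. ennreal (v x) \<partial>lebesgue) < \<infinity>"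
proof -
  have "integrable lebesgue (\<lambda>x. indicat_real C x *\<^sub>R v x)"
    using assms unfolding locally_integrable_on_def set_integrable_def by blast
  then have "(\<integral>\<^sup>+x. ennreal (norm (indicat_real C x *\<^sub>R v x)) \<partial>lebesgue) < \<infinity>"
    unfolding integrable_iff_bounded by (rule conjunct2)
  moreover have "(\<integral>\<^sup>+x\<in>C. ennreal (v x) \<partial>lebesgue) \<le> (\<integral>\<^sup>+x. ennreal (norm (indicat_real C x *\<^sub>R v x)) \<partial>lebesgue)"
    by (intro nn_integral_mono) (auto simp: indicator_def intro!: ennreal_leI)
  ultimately show ?thesis by order
qed

lemma compact_neighbourhood:
  fixes C :: "'a::euclidean_space set"
  assumes "compact C" "open D" "C \<subseteq> D"
  obtains e C' where "0 < e" "compact C'" "C' \<subseteq> D" "\<And>z. z \<in> C \<Longrightarrow> cball z e \<subseteq> C'"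
proof -
  obtain e where e: "0 < e" "(\<Union>x\<in>C. cball x e) \<subseteq> D"
    using compact_subset_open_imp_cball_epsilon_subset[OF assms] .
  have eq: "(\<Union>x\<in>C. cball x e) = {x + y |x y. x \<in> C \<and> y \<in> cball 0 e}" (is "_ = ?S")
  proof (intro equalityI subsetI)
    fix w assume "w \<in> (\<Union>x\<in>C. cball x e)"
    then obtain x where "x \<in> C" "w \<in> cball x e" by blast
    then have "w = x + (w - x) \<and> x \<in> C \<and> w - x \<in> cball 0 e"
      by (auto simp: dist_norm norm_minus_commute)
    then show "w \<in> ?S" by blast
  next
    fix w assume "w \<in> ?S"
    then obtain x y where "w = x + y" "x \<in> C" "y \<in> cball 0 e" by blast
    then show "w \<in> (\<Union>x\<in>C. cball x e)" by (auto simp: dist_norm intro!: bexI[of _ x])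
  qed
  have "compact (\<Union>x\<in>C. cball x e)"
    unfolding eq by (intro compact_sums assms compact_cball)
  then show thesis using that[of e "\<Union>x\<in>C. cball x e"] e by blast
qed

section \<open>Functions bounded by their averages over balls\<close>

text \<open>
  \<open>v\<close> is at most \<open>K\<close> times its average over every ball whose closure lies in \<open>D\<close>. Averages are taken
  in \<^typ>\<open>ennreal\<close>, so they are meaningful for every nonnegative \<open>v\<close>, even a non-integrable one.
  A negative value of \<open>v\<close> is read as \<open>0\<close>.
\<close>

definition mean_bounded :: "real \<Rightarrow> ('a::euclidean_space \<Rightarrow> real) \<Rightarrow> 'a set \<Rightarrow> bool" where
  "mean_bounded K v D \<longleftrightarrow> (\<forall>z r. 0 < r \<and> cball z r \<subseteq> D \<longrightarrow>
     ennreal (v z) \<le> ennreal (K / measure lebesgue (ball z r)) * (\<integral>\<^sup>+w\<in>ball z r. ennreal (v w) \<partial>lebesgue))"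

lemma mean_bounded_imp_bounded:
  fixes v :: "'a::euclidean_space \<Rightarrow> real"
  assumes mean: "mean_bounded K v D" and "open D" and int: "v locally_integrable_on D"
    and "compact C" "C \<subseteq> D"
  obtains S where "0 < S" "\<And>z. z \<in> C \<Longrightarrow> v z < S"
proof -
  obtain e C' where e: "0 < e" "compact C'" "C' \<subseteq> D" "\<And>z. z \<in> C \<Longrightarrow> cball z e \<subseteq> C'"
    using compact_neighbourhood[OF assms(4,2,5)] by metis
  define b where "b = ennreal (K / measure lebesgue (ball (0::'a) e)) * (\<integral>\<^sup>+w\<in>C'. ennreal (v w) \<partial>lebesgue)"
  have fin: "b < \<infinity>"
    unfolding b_def using locally_integrable_nn_integral_finite[OF int e(2,3)]
    by (simp add: ennreal_mult_less_top)
  have "v z < enn2real b + 1" if "z \<in> C" for z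
  proof -
    have "ennreal (v z) \<le> ennreal (K / measure lebesgue (ball z e)) * (\<integral>\<^sup>+w\<in>ball z e. ennreal (v w) \<partial>lebesgue)"
      using mean e(1,3) e(4)[OF that] unfolding mean_bounded_def by blast
    also have "measure lebesgue (ball z e) = measure lebesgue (ball (0::'a) e)"
      by (rule measure_ball_translate[OF e(1)])
    also have "ennreal (K / measure lebesgue (ball (0::'a) e)) * (\<integral>\<^sup>+w\<in>ball z e. ennreal (v w) \<partial>lebesgue) \<le> b"
      unfolding b_def using e(4)[OF that] ball_subset_cball[of z e]
      by (intro mult_left_mono nn_integral_mono) (auto simp: indicator_def)
    finally have "ennreal (v z) \<le> ennreal (enn2real b)"
      using fin by simp
    then have "v z \<le> enn2real b"
      by (simp add: ennreal_le_iff2) (metis enn2real_nonneg nle_le order_trans)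
    then show ?thesis by simp
  qed
  moreover have "0 < enn2real b + 1" by (simp add: add_nonneg_pos)
  ultimately show thesis using that by blast
qed

text \<open>
  If \<open>v\<close> does not exceed \<open>L * v z\<close> on a ball around \<open>z\<close>, its average can be as large as \<open>v z / K\<close> only
  if \<open>v \<ge> v z / (2 * K)\<close> on a fixed proportion of the ball: the part where \<open>v\<close> is smaller accounts
  for at most half of that average.
\<close>

lemma superlevel_set_large:
  fixes v :: "'a::euclidean_space \<Rightarrow> real"
  assumes mean: "mean_bounded K v D" and int: "v locally_integrable_on D"
    and K: "0 < K" and L: "0 < L" and r: "0 < r" "cball z r \<subseteq> D" and pos: "0 < v z"
    and upper: "\<And>w. w \<in> ball z r \<Longrightarrow> v w \<le> L * v z"
  shows "{w \<in> ball z r. v z / (2 * K) \<le> v w} \<in> sets lebesgue"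
    and "ennreal (measure lebesgue (ball z r) / (2 * K * L))
          \<le> emeasure lebesgue {w \<in> ball z r. v z / (2 * K) \<le> v w}"
proof -
  let ?B = "ball z r" and ?t = "v z"
  let ?E = "{w \<in> ?B. ?t / (2 * K) \<le> v w}"
  have "v \<in> borel_measurable (lebesgue_on ?B)"
    using locally_integrable_measurable[OF int compact_cball r(2) ball_subset_cball] .
  then have "{w \<in> space (lebesgue_on ?B). ?t / (2 * K) \<le> v w} \<in> sets (lebesgue_on ?B)"
    by measurable
  then show E: "?E \<in> sets lebesgue"
    by (simp add: sets_restrict_space_iff)
  have finE: "emeasure lebesgue ?E = ennreal (measure lebesgue ?E)"
  proof (rule emeasure_eq_ennreal_measure)
    have "emeasure lebesgue ?E \<le> emeasure lebesgue ?B"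
      by (intro emeasure_mono) auto
    then show "emeasure lebesgue ?E \<noteq> top"
      using emeasure_ball_eq[of z r] by (metis ennreal_neq_top top.extremum_uniqueI)
  qed
  define b where "b = measure lebesgue ?B"
  have b: "0 < b" unfolding b_def using r(1) by (rule measure_ball_pos)
  have "(\<integral>\<^sup>+w\<in>?B. ennreal (v w) \<partial>lebesgue)
      \<le> (\<integral>\<^sup>+w. ennreal (?t / (2 * K)) * indicator ?B w + ennreal (L * ?t) * indicator ?E w \<partial>lebesgue)"
  proof (intro nn_integral_mono)
    fix w
    have "ennreal (v w) \<le> ennreal (L * ?t)" if "w \<in> ?B"
      using upper[OF that] by (rule ennreal_leI)
    moreover have "ennreal (v w) \<le> ennreal (?t / (2 * K))" if "\<not> ?t / (2 * K) \<le> v w"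
      using that by (intro ennreal_leI) simp
    ultimately show "ennreal (v w) * indicator ?B w
        \<le> ennreal (?t / (2 * K)) * indicator ?B w + ennreal (L * ?t) * indicator ?E w"
      by (auto simp: indicator_def add_increasing)
  qed
  also have "\<dots> = ennreal (?t / (2 * K)) * ennreal b + ennreal (L * ?t) * emeasure lebesgue ?E"
  proof -
    have B: "?B \<in> sets lebesgue" by simp
    show ?thesis
      using E B unfolding b_def emeasure_ball_eq[symmetric]
      by (subst nn_integral_add) (simp_all only: nn_integral_cmult_indicator borel_measurable_indicator
            borel_measurable_times_ennreal borel_measurable_const)
  qed
  also have "\<dots> = ennreal (?t / (2 * K) * b + L * ?t * measure lebesgue ?E)"
    unfolding finE using K L pos b by (simp add: ennreal_mult[symmetric] ennreal_plus[symmetric] del: ennreal_plus)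
  finally have *: "(\<integral>\<^sup>+w\<in>?B. ennreal (v w) \<partial>lebesgue) \<le> ennreal (?t / (2 * K) * b + L * ?t * measure lebesgue ?E)" .
  have "ennreal ?t \<le> ennreal (K / b) * (\<integral>\<^sup>+w\<in>?B. ennreal (v w) \<partial>lebesgue)"
    using mean r unfolding mean_bounded_def b_def by blast
  also have "\<dots> \<le> ennreal (K / b) * ennreal (?t / (2 * K) * b + L * ?t * measure lebesgue ?E)"
    by (intro mult_left_mono *) simp
  also have "\<dots> = ennreal (K / b * (?t / (2 * K) * b + L * ?t * measure lebesgue ?E))"
    using K b pos L by (intro ennreal_mult[symmetric]) auto
  finally have "?t \<le> K / b * (?t / (2 * K) * b + L * ?t * measure lebesgue ?E)"
    using K b pos L by (subst (asm) ennreal_le_iff) (auto intro!: mult_nonneg_nonneg add_nonneg_nonneg)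
  also have "\<dots> = ?t * (1 / 2 + K * L * measure lebesgue ?E / b)"
    using K b by (simp add: field_simps)
  finally have "1 \<le> 1 / 2 + K * L * measure lebesgue ?E / b"
    using pos by simp
  then have "b / (2 * K * L) \<le> measure lebesgue ?E"
    using K b L by (simp add: field_simps)
  then show "ennreal (measure lebesgue ?B / (2 * K * L)) \<le> emeasure lebesgue ?E"
    unfolding finE b_def by (rule ennreal_leI)
qed

lemma growth_pow:
  fixes \<phi> :: "real \<Rightarrow> real"
  assumes growth: "\<And>t. 0 \<le> t \<Longrightarrow> 2 * \<phi> t \<le> \<phi> (A * t)" and A: "0 \<le> A" and t: "0 \<le> t"
  shows "2 ^ k * \<phi> t \<le> \<phi> (A ^ k * t)"
proof (induction k)
  case (Suc k)
  have "2 ^ Suc k * \<phi> t \<le> 2 * \<phi> (A ^ k * t)" using Suc by simp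
  also have "\<dots> \<le> \<phi> (A * (A ^ k * t))" using A t by (intro growth) simp
  finally show ?case by (simp add: mult.assoc)
qed simp

text \<open>
  The mean value inequality survives composition with a function \<open>\<psi>\<close> of at least power growth, up to
  dividing the argument on the left by \<open>2 * K\<close>. With \<open>L = A ^ N\<close>, \<open>N\<close> the dimension, either \<open>v\<close> stays
  below \<open>L * v z\<close> on the ball of half the radius, and the preceding lemma applies; or it exceeds this
  value at some \<open>x\<close> there, and one passes to the ball of half the radius around \<open>x\<close>. In the second case
  the left-hand side is multiplied by at least \<open>2 ^ N\<close>, which pays for the smaller ball. Since \<open>v\<close>
  is bounded on compact sets, the second case occurs only finitely often. The constant
  depends only on \<open>K\<close>, \<open>A\<close> and \<open>N\<close>; this makes the estimate uniform over slices.
\<close>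

lemma mean_bounded_compose:
  fixes v :: "'a::euclidean_space \<Rightarrow> real"
  assumes mean: "mean_bounded K v D" and D: "open D" and int: "v locally_integrable_on D"
    and K: "0 < K" and nonneg: "\<And>z. z \<in> D \<Longrightarrow> 0 \<le> v z"
    and \<psi>: "mono_on {0..} \<psi>" "\<And>t. 0 \<le> t \<Longrightarrow> 0 \<le> \<psi> t"
    and growth: "\<And>t. 0 \<le> t \<Longrightarrow> 2 * \<psi> t \<le> \<psi> (A * t)" and A: "2 \<le> A"
    and r: "0 < r" "cball z r \<subseteq> D"
  shows "ennreal (\<psi> (v z / (2 * K)))
    \<le> ennreal (2 * K * (2 * A) ^ DIM('a) / measure lebesgue (ball z r))
       * (\<integral>\<^sup>+w\<in>ball z r. ennreal (\<psi> (v w)) \<partial>lebesgue)"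
proof -
  define L where "L = A ^ DIM('a)"
  define c where "c = 2 * K * L * 2 ^ DIM('a)"
  have L: "2 \<le> L"
    using A unfolding L_def by (metis DIM_positive One_nat_def Suc_leI one_le_numeral order_trans power_increasing power_one_right)
  have c: "0 < c" using K L unfolding c_def by simp
  obtain S where S: "0 < S" "\<And>w. w \<in> cball z r \<Longrightarrow> v w < S"
    using mean_bounded_imp_bounded[OF mean D int compact_cball r(2)] by metis
  \<comment> \<open>\<open>k\<close> bounds the number of remaining passages to a smaller ball.\<close>
  have claim: "ennreal (\<psi> (v y / (2 * K)))
        \<le> ennreal (c / measure lebesgue (ball y \<rho>)) * (\<integral>\<^sup>+w\<in>ball y \<rho>. ennreal (\<psi> (v w)) \<partial>lebesgue)"
    if "0 < \<rho>" "cball y \<rho> \<subseteq> cball z r" "S < L ^ k * v y" for k y \<rho>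
    using that
  proof (induction k arbitrary: y \<rho>)
    case 0
    have "y \<in> cball y \<rho>" using 0(1) by simp
    then have "y \<in> cball z r" using 0(2) by blast
    then show ?case using 0 S(2)[of y] by simp
  next
    case (Suc k)
    let ?t = "v y / (2 * K)"
    have "0 < L ^ Suc k * v y" using Suc.prems(3) S(1) by linarith
    then have vy: "0 < v y" using L by (simp add: zero_less_mult_iff not_less[symmetric])
       (metis L mult_nonneg_nonneg not_less order.trans zero_le_numeral zero_le_power)
    then have t: "0 < ?t" using K by simp
    have half: "measure lebesgue (ball x (\<rho> / 2)) = measure lebesgue (ball y \<rho>) / 2 ^ DIM('a)" for x :: 'a
      using Suc.prems(1) by (simp only: measure_ball_scale[of "\<rho> / 2" x 0] measure_ball_scale[of \<rho> y 0] half_gt_zero) (simp add: power_divide)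
    have bpos: "0 < measure lebesgue (ball y \<rho>)" using Suc.prems(1) by (rule measure_ball_pos)
    show ?case
    proof (cases "\<exists>x\<in>ball y (\<rho> / 2). L * v y < v x")
      case True
      then obtain x where x: "x \<in> ball y (\<rho> / 2)" "L * v y < v x" by blast
      have sub: "cball x (\<rho> / 2) \<subseteq> cball y \<rho>" "ball x (\<rho> / 2) \<subseteq> ball y \<rho>"
        using x(1) by (auto simp: subset_iff) (metric)+
      have "S < L ^ k * v x"
      proof -
        have "S < L ^ k * (L * v y)" using Suc.prems(3) by (simp add: mult_ac)
        also have "\<dots> \<le> L ^ k * v x" using x(2) L by (intro mult_left_mono) auto
        finally show ?thesis .
      qed
      then have IH: "ennreal (\<psi> (v x / (2 * K)))
        \<le> ennreal (c / measure lebesgue (ball x (\<rho> / 2))) * (\<integral>\<^sup>+w\<in>ball x (\<rho> / 2). ennreal (\<psi> (v w)) \<partial>lebesgue)"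
        using Suc.prems sub by (intro Suc.IH) auto
      have "2 ^ DIM('a) * \<psi> ?t \<le> \<psi> (L * ?t)"
        unfolding L_def using t A by (intro growth_pow growth) auto
      also have "\<dots> \<le> \<psi> (v x / (2 * K))"
        using x(2) K L vy by (intro mono_onD[OF \<psi>(1)]) (auto simp: divide_right_mono intro!: divide_nonneg_pos order.trans[OF _ less_imp_le[OF x(2)]])
      finally have "ennreal (2 ^ DIM('a)) * ennreal (\<psi> ?t) \<le> ennreal (\<psi> (v x / (2 * K)))"
        using \<psi>(2) t by (simp add: ennreal_mult[symmetric] ennreal_leI)
      also have "\<dots> \<le> ennreal (c / measure lebesgue (ball x (\<rho> / 2))) * (\<integral>\<^sup>+w\<in>ball y \<rho>. ennreal (\<psi> (v w)) \<partial>lebesgue)"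
        using sub(2) by (intro order.trans[OF IH] mult_left_mono nn_integral_mono) (auto simp: indicator_def)
      also have "ennreal (c / measure lebesgue (ball x (\<rho> / 2))) = ennreal (2 ^ DIM('a)) * ennreal (c / measure lebesgue (ball y \<rho>))"
        unfolding half using c bpos by (simp add: ennreal_mult[symmetric])
      finally show ?thesis
        by (simp add: mult.assoc ennreal_mult_le_mult_iff)
    next
      case False
      have sub: "cball y (\<rho> / 2) \<subseteq> D" "ball y (\<rho> / 2) \<subseteq> ball y \<rho>"
        using Suc.prems(1,2) r(2) by (auto simp: subset_iff)
      let ?E = "{w \<in> ball y (\<rho> / 2). ?t \<le> v w}"
      have upper: "v w \<le> L * v y" if "w \<in> ball y (\<rho> / 2)" for w
        using False that by (meson not_less)
      have "0 < L" "0 < \<rho> / 2" using L Suc.prems(1) by simp_all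
      then have E: "?E \<in> sets lebesgue"
        "ennreal (measure lebesgue (ball y (\<rho> / 2)) / (2 * K * L)) \<le> emeasure lebesgue ?E"
        using superlevel_set_large[OF mean int K _ _ sub(1) vy upper] by blast+
      have "ennreal (measure lebesgue (ball y \<rho>) / c) * ennreal (\<psi> ?t) \<le> emeasure lebesgue ?E * ennreal (\<psi> ?t)"
      proof (rule mult_right_mono)
        have "measure lebesgue (ball y \<rho>) / c = measure lebesgue (ball y (\<rho> / 2)) / (2 * K * L)"
          unfolding half c_def by (simp add: field_simps)
        then show "ennreal (measure lebesgue (ball y \<rho>) / c) \<le> emeasure lebesgue ?E"
          using E(2) by metis
      qed simp
      also have "\<dots> = (\<integral>\<^sup>+w. ennreal (\<psi> ?t) * indicator ?E w \<partial>lebesgue)"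
        by (subst nn_integral_cmult_indicator[OF E(1)]) (rule mult.commute)
      also have "\<dots> \<le> (\<integral>\<^sup>+w\<in>ball y \<rho>. ennreal (\<psi> (v w)) \<partial>lebesgue)"
        using sub(2) t by (intro nn_integral_mono) (auto simp: indicator_def intro!: ennreal_leI mono_onD[OF \<psi>(1)])
      finally have "ennreal (c / measure lebesgue (ball y \<rho>)) * (ennreal (measure lebesgue (ball y \<rho>) / c) * ennreal (\<psi> ?t))
         \<le> ennreal (c / measure lebesgue (ball y \<rho>)) * (\<integral>\<^sup>+w\<in>ball y \<rho>. ennreal (\<psi> (v w)) \<partial>lebesgue)"
        by (intro mult_left_mono) auto
      moreover have "ennreal (c / measure lebesgue (ball y \<rho>)) * ennreal (measure lebesgue (ball y \<rho>) / c) = 1"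
        using c bpos by (simp add: ennreal_mult[symmetric])
      ultimately show ?thesis by (simp add: mult.assoc[symmetric])
    qed
  qed
  have z: "z \<in> cball z r" "z \<in> D" using r by auto
  show ?thesis
  proof (cases "v z = 0")
    case True
    \<comment> \<open>The growth condition at \<open>0\<close> reads \<open>2 * \<psi> 0 \<le> \<psi> 0\<close>.\<close>
    have "\<psi> 0 \<le> 0" using growth[of 0] by simp
    then have "\<psi> (v z / (2 * K)) \<le> 0" using True by simp
    then show ?thesis by (simp add: ennreal_neg)
  next
    case False
    then have vz: "0 < v z" using nonneg z(2) by force
    obtain k where "S / v z < L ^ k" using real_arch_pow[of L "S / v z"] L by auto
    then have "S < L ^ k * v z" using vz by (simp add: field_simps)
    from claim[OF r(1) order.refl this] show ?thesis
      unfolding c_def L_def by (simp add: power_mult_distrib mult_ac)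
  qed
qed

section \<open>Permissible functions\<close>

text \<open>
  Subtracting \<open>\<psi>\<^sub>1 0\<close> inside \<open>\<psi>\<^sub>2 \<circ> \<psi>\<^sub>1\<close> gives a minorant with at least power growth. The shifted convex
  function vanishes at \<open>0\<close>, hence grows at least linearly, and the doubling of the inverse of \<open>\<psi>\<^sub>2\<close>
  says that \<open>\<psi>\<^sub>2\<close> itself doubles when its argument is multiplied by a fixed constant. Without the
  shift the growth inequality would fail at \<open>0\<close> whenever \<open>\<psi> 0 > 0\<close>.
\<close>

lemma permissible_minorant:
  assumes "permissible \<psi>" "\<not> \<psi> constant_on {0..}"
  obtains \<phi> A t\<^sub>0 where "mono_on {0..} \<phi>" "\<And>t. 0 \<le> t \<Longrightarrow> 0 \<le> \<phi> t" "\<And>t. 0 \<le> t \<Longrightarrow> \<phi> t \<le> \<psi> t"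
    "2 \<le> A" "\<And>t. 0 \<le> t \<Longrightarrow> 2 * \<phi> t \<le> \<phi> (A * t)" "0 \<le> t\<^sub>0" "0 < \<phi> t\<^sub>0"
proof -
  obtain \<psi>\<^sub>1 \<psi>\<^sub>2 where p1: "\<psi>\<^sub>1 ` {0..} \<subseteq> {0..}" "mono_on {0..} \<psi>\<^sub>1" "convex_on {0..} \<psi>\<^sub>1"
    and p2: "\<psi>\<^sub>2 ` {0..} = {0..}" "strict_mono_on {0..} \<psi>\<^sub>2" "delta2_condition (inv_into {0..} \<psi>\<^sub>2)"
    and \<psi>: "\<And>t. 0 \<le> t \<Longrightarrow> \<psi> t = \<psi>\<^sub>2 (\<psi>\<^sub>1 t)"
    using assms(1) unfolding permissible_def by auto
  obtain C where C: "1 \<le> C" "\<And>s. 0 \<le> s \<Longrightarrow> inv_into {0..} \<psi>\<^sub>2 (2 * s) \<le> C * inv_into {0..} \<psi>\<^sub>2 s"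
    using p2(3) unfolding delta2_condition_def by blast
  define A where "A = max 2 C"
  define h where "h t = \<psi>\<^sub>1 t - \<psi>\<^sub>1 0" for t
  have A: "2 \<le> A" "C \<le> A" unfolding A_def by auto
  have mono2: "\<psi>\<^sub>2 s \<le> \<psi>\<^sub>2 t" if "0 \<le> s" "s \<le> t" for s t
    using strict_mono_on_leD[OF p2(2)] that by auto
  have nonneg2: "0 \<le> \<psi>\<^sub>2 t" if "0 \<le> t" for t
    using p2(1) that by (metis atLeast_iff imageI)
  have mono_h: "h s \<le> h t" if "0 \<le> s" "s \<le> t" for s t
    using mono_onD[OF p1(2)] that by (auto simp: h_def)
  have h0: "0 \<le> h t" if "0 \<le> t" for t using mono_h[of 0 t] that by (simp add: h_def)
  have h_le: "h t \<le> \<psi>\<^sub>1 t" for t using p1(1) by (auto simp: h_def)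
  have growth2: "2 * \<psi>\<^sub>2 t \<le> \<psi>\<^sub>2 (A * t)" if t: "0 \<le> t" for t
  proof -
    have inj: "inj_on \<psi>\<^sub>2 {0..}" using p2(2) by (rule strict_mono_on_imp_inj_on)
    define s where "s = inv_into {0..} \<psi>\<^sub>2 (2 * \<psi>\<^sub>2 t)"
    have m: "2 * \<psi>\<^sub>2 t \<in> \<psi>\<^sub>2 ` {0..}" using p2(1) nonneg2[OF t] by auto
    have s: "\<psi>\<^sub>2 s = 2 * \<psi>\<^sub>2 t" "0 \<le> s"
      unfolding s_def using f_inv_into_f[OF m] inv_into_into[OF m] by auto
    have "s \<le> C * t"
      using C(2)[OF nonneg2[OF t]] inv_into_f_f[OF inj, of t] t unfolding s_def by simp
    also have "\<dots> \<le> A * t" using A(2) t by (rule mult_right_mono)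
    finally show ?thesis using mono2[OF s(2)] s(1) by metis
  qed
  have growth1: "A * h t \<le> h (A * t)" if t: "0 \<le> t" for t
  proof -
    \<comment> \<open>Convexity on the segment from \<open>0\<close> to \<open>A * t\<close>, of which \<open>t\<close> is a convex combination.\<close>
    have "\<psi>\<^sub>1 ((1 - 1 / A) *\<^sub>R 0 + (1 / A) *\<^sub>R (A * t)) \<le> (1 - 1 / A) * \<psi>\<^sub>1 0 + (1 / A) * \<psi>\<^sub>1 (A * t)"
      using A(1) t by (intro convex_onD[OF p1(3)]) auto
    then have "h t \<le> h (A * t) / A"
      using A(1) by (simp add: h_def field_simps)
    then show ?thesis using A(1) by (simp add: field_simps)
  qed
  have "\<exists>t\<^sub>0\<ge>0. 0 < h t\<^sub>0"
  proof (rule ccontr)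
    assume "\<not> (\<exists>t\<^sub>0\<ge>0. 0 < h t\<^sub>0)"
    then have "\<not> 0 < h t" if "0 \<le> t" for t using that by blast
    then have const: "\<psi>\<^sub>1 t = \<psi>\<^sub>1 0" if "0 \<le> t" for t
      using h0[OF that] that unfolding h_def by force
    have "\<psi> t = \<psi>\<^sub>2 (\<psi>\<^sub>1 0)" if "0 \<le> t" for t
      using \<psi>[OF that] unfolding const[OF that] .
    then have "\<psi> constant_on {0..}"
      unfolding constant_on_def by (metis atLeast_iff)
    then show False using assms(2) by blast
  qed
  then obtain t\<^sub>0 where t0: "0 \<le> t\<^sub>0" "0 < h t\<^sub>0" by blast
  show thesis
  proof (rule that[of "\<lambda>t. \<psi>\<^sub>2 (h t)" A t\<^sub>0])
    show "mono_on {0..} (\<lambda>t. \<psi>\<^sub>2 (h t))"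
      by (intro mono_onI mono2 h0 mono_h) auto
    show "\<psi>\<^sub>2 (h t) \<le> \<psi> t" if "0 \<le> t" for t
      using mono2[OF h0[OF that] h_le] \<psi>[OF that] by simp
    show "2 * \<psi>\<^sub>2 (h t) \<le> \<psi>\<^sub>2 (h (A * t))" if "0 \<le> t" for t
    proof -
      have "2 * \<psi>\<^sub>2 (h t) \<le> \<psi>\<^sub>2 (A * h t)" using growth2 h0 that by blast
      also have "\<dots> \<le> \<psi>\<^sub>2 (h (A * t))" using growth1[OF that] h0[OF that] A(1) by (intro mono2) auto
      finally show ?thesis .
    qed
    show "0 < \<psi>\<^sub>2 (h t\<^sub>0)"
      using strict_mono_onD[OF p2(2), of 0 "h t\<^sub>0"] t0(2) nonneg2[of 0] by simp
  qed (use nonneg2 h0 A t0 in auto)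
qed

section \<open>Truncations of quasi-nearly subharmonic functions\<close>

lemma truncate_below_nonneg:
  assumes "0 \<le> M"
  shows "0 \<le> truncate_below M t"
  unfolding truncate_below_def using assms
  by (cases t) (auto simp: max_def real_of_ereal_pos)

lemma truncate_below_zero: "truncate_below 0 t = pos_part t"
  by (simp add: truncate_below_def pos_part_def zero_ereal_def)

lemma pos_part_nonneg: "0 \<le> pos_part t"
  using truncate_below_nonneg[of 0 t] by (simp add: truncate_below_zero)

lemma truncate_below_le:
  assumes "0 \<le> M"
  shows "truncate_below M t \<le> pos_part t + M"
  unfolding truncate_below_def pos_part_def using assms
  by (cases t) (auto simp: max_def zero_ereal_def)

lemma borel_measurable_truncate_below [measurable (raw)]:
  "f \<in> borel_measurable N \<Longrightarrow> (\<lambda>x. truncate_below M (f x)) \<in> borel_measurable N"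
  unfolding truncate_below_def
  by (intro borel_measurable_real_of_ereal borel_measurable_ereal_add borel_measurable_max borel_measurable_const)

lemma quasi_nearly_subharmonic_imp_mean_bounded:
  fixes u :: "'a::euclidean_space \<Rightarrow> ereal"
  assumes "quasi_nearly_subharmonic_on K u D" "0 \<le> M"
  shows "mean_bounded K (\<lambda>x. truncate_below M (u x)) D"
  unfolding mean_bounded_def
proof (intro allI impI, elim conjE)
  fix z :: 'a and r :: real
  assume r: "0 < r" "cball z r \<subseteq> D"
  define I where "I = (LINT y:ball z r|lebesgue. truncate_below M (u y))"
  have K: "0 \<le> K" using assms(1) by (simp add: quasi_nearly_subharmonic_on_def)
  have I: "0 \<le> I"
    unfolding I_def set_lebesgue_integral_def
    using truncate_below_nonneg[OF assms(2)] by (intro integral_nonneg_AE) auto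
  have "ennreal I \<le> (\<integral>\<^sup>+w. ennreal (indicat_real (ball z r) w *\<^sub>R truncate_below M (u w)) \<partial>lebesgue)"
    unfolding I_def set_lebesgue_integral_def
    using truncate_below_nonneg[OF assms(2)] by (intro integral_le_nn_integral) auto
  also have "\<dots> = (\<integral>\<^sup>+w\<in>ball z r. ennreal (truncate_below M (u w)) \<partial>lebesgue)"
    by (intro nn_integral_cong) (auto simp: indicator_def)
  finally have *: "ennreal I \<le> (\<integral>\<^sup>+w\<in>ball z r. ennreal (truncate_below M (u w)) \<partial>lebesgue)" .
  have "truncate_below M (u z) \<le> K / measure lebesgue (ball z r) * I"
  proof -
    have "truncate_below M (u z) \<le> K / (measure lebesgue (ball (0::'a) 1) * r ^ DIM('a)) * I"
      using assms r unfolding quasi_nearly_subharmonic_on_def I_def by simp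
    then show ?thesis by (simp only: measure_ball_scale[OF r(1), of z 0])
  qed
  then have "ennreal (truncate_below M (u z)) \<le> ennreal (K / measure lebesgue (ball z r)) * ennreal I"
    using I K by (simp add: ennreal_mult[symmetric] ennreal_leI)
  also have "\<dots> \<le> ennreal (K / measure lebesgue (ball z r)) * (\<integral>\<^sup>+w\<in>ball z r. ennreal (truncate_below M (u w)) \<partial>lebesgue)"
    by (intro mult_left_mono *) simp
  finally show "ennreal (truncate_below M (u z))
    \<le> ennreal (K / measure lebesgue (ball z r)) * (\<integral>\<^sup>+w\<in>ball z r. ennreal (truncate_below M (u w)) \<partial>lebesgue)" .
qed

section \<open>Estimates in product spaces\<close>

text \<open>
  Tonelli's theorem for a Lebesgue measurable \<open>f\<close>, as an inequality. The slices of \<open>f\<close> are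
  measurable only for almost every \<open>x\<close>, and no measurability is required of \<open>g\<close>.
\<close>

lemma iterated_mean_le:
  fixes f :: "'a::euclidean_space \<times> 'b::euclidean_space \<Rightarrow> ennreal"
  assumes f: "f \<in> borel_measurable (lebesgue_on (A \<times> B))" and AB: "A \<times> B \<in> sets lebesgue"
    and outer: "p \<le> c * (\<integral>\<^sup>+x\<in>A. g x \<partial>lebesgue)"
    and inner: "AE x in lebesgue. x \<in> A \<longrightarrow> g x \<le> d * (\<integral>\<^sup>+y\<in>B. f (x, y) \<partial>lebesgue)"
  shows "p \<le> c * d * (\<integral>\<^sup>+z\<in>A \<times> B. f z \<partial>lebesgue)"
proof -
  \<comment> \<open>All slices of a Borel representative of \<open>f\<close> are measurable.\<close>
  define F where "F z = f z * indicator (A \<times> B) z" for z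
  have "F \<in> borel_measurable lebesgue"
    using f AB unfolding F_def by (subst (asm) borel_measurable_restrict_space_iff_ennreal) simp_all
  then obtain F' where F': "F' \<in> borel_measurable lborel" "AE z in lborel. F z = F' z"
    using completion_ex_borel_measurable by blast
  then have F'm [measurable]: "F' \<in> borel_measurable (lborel \<Otimes>\<^sub>M lborel)"
    by (simp add: lborel_prod)
  have "AE z in (lborel :: 'a measure) \<Otimes>\<^sub>M (lborel :: 'b measure). F z = F' z"
    using F'(2) unfolding lborel_prod .
  then have "AE x in lborel. AE y in lborel. F (x, y) = F' (x, y)"
    by (rule lborel_pair.AE_pair)
  then have "AE x in lebesgue. AE y in lebesgue. F (x, y) = F' (x, y)"
    by (simp add: AE_completion_iff)
  then have "AE x in lebesgue. (\<integral>\<^sup>+y. F (x, y) \<partial>lebesgue) = (\<integral>\<^sup>+y. F' (x, y) \<partial>lborel)"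
  proof eventually_elim
    case (elim x)
    then show ?case
      unfolding nn_integral_completion AE_completion_iff by (rule nn_integral_cong_AE)
  qed
  with inner have "AE x in lebesgue. g x * indicator A x \<le> d * (\<integral>\<^sup>+y. F' (x, y) \<partial>lborel)"
  proof eventually_elim
    case (elim x)
    have "(\<integral>\<^sup>+y. F (x, y) \<partial>lebesgue) = (\<integral>\<^sup>+y\<in>B. f (x, y) \<partial>lebesgue)" if "x \<in> A"
      using that by (intro nn_integral_cong) (simp add: F_def indicator_times)
    then show ?case using elim by (cases "x \<in> A") auto
  qed
  then have "(\<integral>\<^sup>+x\<in>A. g x \<partial>lebesgue) \<le> (\<integral>\<^sup>+x. d * (\<integral>\<^sup>+y. F' (x, y) \<partial>lborel) \<partial>lebesgue)"
    by (rule nn_integral_mono_AE)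
  also have "\<dots> = d * (\<integral>\<^sup>+x. (\<integral>\<^sup>+y. F' (x, y) \<partial>lborel) \<partial>lborel)"
    unfolding nn_integral_completion by (intro nn_integral_cmult) measurable
  also have "(\<integral>\<^sup>+x. (\<integral>\<^sup>+y. F' (x, y) \<partial>lborel) \<partial>lborel) = (\<integral>\<^sup>+z. F' z \<partial>lborel)"
    using lborel.nn_integral_fst[OF F'm] by (simp add: lborel_prod)
  also have "\<dots> = (\<integral>\<^sup>+z. F z \<partial>lebesgue)"
    unfolding nn_integral_completion using F'(2) by (intro nn_integral_cong_AE) auto
  finally have "(\<integral>\<^sup>+x\<in>A. g x \<partial>lebesgue) \<le> d * (\<integral>\<^sup>+z\<in>A \<times> B. f z \<partial>lebesgue)"
    unfolding F_def .
  then have "c * (\<integral>\<^sup>+x\<in>A. g x \<partial>lebesgue) \<le> c * (d * (\<integral>\<^sup>+z\<in>A \<times> B. f z \<partial>lebesgue))"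
    by (intro mult_left_mono) auto
  with outer show ?thesis by (simp add: mult.assoc)
qed

lemma cball_Times_half_subset_ball:
  fixes a :: "'a::euclidean_space" and b :: "'b::euclidean_space"
  assumes "0 < r"
  shows "cball a (r / 2) \<times> cball b (r / 2) \<subseteq> ball (a, b) r"
proof safe
  fix x y assume "x \<in> cball a (r / 2)" "y \<in> cball b (r / 2)"
  then have "(dist a x)\<^sup>2 + (dist b y)\<^sup>2 \<le> (r / 2)\<^sup>2 + (r / 2)\<^sup>2"
    by (intro add_mono power_mono) auto
  also have "\<dots> < r\<^sup>2" using assms by (simp add: power2_eq_square field_simps)
  finally show "(x, y) \<in> ball (a, b) r"
    using assms by (simp add: dist_Pair_Pair real_less_lsqrt)
qed

lemma measure_ball_Times_le:
  fixes a :: "'a::euclidean_space" and b :: "'b::euclidean_space"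
  assumes "0 < r"
  shows "measure lebesgue (ball a (r / 2)) * measure lebesgue (ball b (r / 2))
    \<le> measure lebesgue (ball (a, b) r)"
proof -
  have "ennreal (measure lebesgue (ball a (r / 2)) * measure lebesgue (ball b (r / 2)))
      = emeasure lborel (ball a (r / 2)) * emeasure lborel (ball b (r / 2))"
    using emeasure_ball_eq[of a "r / 2"] emeasure_ball_eq[of b "r / 2"] by (simp add: ennreal_mult)
  also have "\<dots> = emeasure (lborel \<Otimes>\<^sub>M lborel) (ball a (r / 2) \<times> ball b (r / 2))"
    by (rule lborel.emeasure_pair_measure_Times[symmetric]) auto
  also have "\<dots> \<le> emeasure lborel (ball (a, b) r)"
    unfolding lborel_prod
  proof (rule emeasure_mono)
    show "ball a (r / 2) \<times> ball b (r / 2) \<subseteq> ball (a, b) r"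
      using cball_Times_half_subset_ball[OF assms, of a b]
      by (meson Sigma_mono ball_subset_cball order.trans)
  qed simp
  also have "\<dots> = ennreal (measure lebesgue (ball (a, b) r))"
    using emeasure_ball_eq[of "(a, b)" r] by simp
  finally show ?thesis by (simp add: ennreal_le_iff)
qed

lemma open_slices:
  assumes "open \<Omega>"
  shows "open {x. (x, y) \<in> \<Omega>}" "open {y. (x, y) \<in> \<Omega>}"
proof -
  have "open ((\<lambda>x. (x, y)) -` \<Omega>)" "open ((\<lambda>y. (x, y)) -` \<Omega>)"
    using assms by (auto intro!: open_vimage continuous_intros)
  then show "open {x. (x, y) \<in> \<Omega>}" "open {y. (x, y) \<in> \<Omega>}"
    by (simp_all add: vimage_def)
qed

text \<open>
  With a minorant \<open>\<phi>\<close> of \<open>\<psi>\<close> as above, the one-variable estimate is applied first in \<open>x\<close>, to the function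
  \<open>t \<mapsto> \<phi> (t / (2 * K\<^sub>2))\<close>, and then in \<open>y\<close>, to \<open>\<phi>\<close>. So \<open>\<phi> (v / (4 * K\<^sub>1 * K\<^sub>2))\<close> is at most
  a constant times an integral of \<open>\<psi> \<circ> v\<close> over a compact set. As \<open>\<phi>\<close> is unbounded, this bounds \<open>v\<close>.
\<close>

lemma separately_mean_bounded_locally_bounded:
  fixes v :: "'a::euclidean_space \<times> 'b::euclidean_space \<Rightarrow> real"
  assumes \<Omega>: "open \<Omega>" and nonneg: "\<And>z. 0 \<le> v z" and K: "0 < K\<^sub>1" "0 < K\<^sub>2"
    and fst: "\<And>y. mean_bounded K\<^sub>1 (\<lambda>x. v (x, y)) {x. (x, y) \<in> \<Omega>}"
      "\<And>y. (\<lambda>x. v (x, y)) locally_integrable_on {x. (x, y) \<in> \<Omega>}"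
    and snd: "AE x in lebesgue. mean_bounded K\<^sub>2 (\<lambda>y. v (x, y)) {y. (x, y) \<in> \<Omega>}
      \<and> (\<lambda>y. v (x, y)) locally_integrable_on {y. (x, y) \<in> \<Omega>}"
    and \<psi>: "permissible \<psi>" "\<not> \<psi> constant_on {0..}" "(\<lambda>z. \<psi> (v z)) locally_integrable_on \<Omega>"
    and C: "compact C" "C \<subseteq> \<Omega>"
  shows "\<exists>S. \<forall>z\<in>C. v z \<le> S"
proof -
  obtain \<phi> A t\<^sub>0 where \<phi>: "mono_on {0..} \<phi>" "\<And>t. 0 \<le> t \<Longrightarrow> 0 \<le> \<phi> t" "\<And>t. 0 \<le> t \<Longrightarrow> \<phi> t \<le> \<psi> t"
    and A: "2 \<le> A" and growth: "\<And>t. 0 \<le> t \<Longrightarrow> 2 * \<phi> t \<le> \<phi> (A * t)" and t0: "0 \<le> t\<^sub>0" "0 < \<phi> t\<^sub>0"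
    using permissible_minorant[OF \<psi>(1,2)] by metis
  obtain e C' where e: "0 < e" "compact C'" "C' \<subseteq> \<Omega>" "\<And>z. z \<in> C \<Longrightarrow> cball z e \<subseteq> C'"
    using compact_neighbourhood[OF C(1) \<Omega> C(2)] by metis
  define c where "c = ennreal (2 * K\<^sub>1 * (2 * A) ^ DIM('a) / measure lebesgue (ball (0::'a) (e / 2)))"
  define d where "d = ennreal (2 * K\<^sub>2 * (2 * A) ^ DIM('b) / measure lebesgue (ball (0::'b) (e / 2)))"
  define I where "I = c * d * (\<integral>\<^sup>+z\<in>C'. ennreal (\<psi> (v z)) \<partial>lebesgue)"
  have fin: "I < \<infinity>"
    unfolding I_def c_def d_def using locally_integrable_nn_integral_finite[OF \<psi>(3) e(2,3)]
    by (simp add: ennreal_mult_less_top)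
  have bound: "ennreal (\<phi> (v (a, b) / (4 * K\<^sub>1 * K\<^sub>2))) \<le> I" if ab: "(a, b) \<in> C" for a b
  proof -
    let ?A = "ball a (e / 2)" and ?B = "ball b (e / 2)"
    have sub: "cball a (e / 2) \<times> cball b (e / 2) \<subseteq> C'"
      using cball_Times_half_subset_ball[OF e(1), of a b] e(4)[OF ab] ball_subset_cball by blast
    have balls: "?A \<times> ?B \<subseteq> C'"
      using sub by (meson Sigma_mono ball_subset_cball order.trans)
    have e2: "0 < e / 2" using e(1) by simp
    have "ennreal (\<phi> (v (a, b) / (2 * K\<^sub>1) / (2 * K\<^sub>2)))
        \<le> c * (\<integral>\<^sup>+x\<in>?A. ennreal (\<phi> (v (x, b) / (2 * K\<^sub>2))) \<partial>lebesgue)"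
      unfolding c_def measure_ball_translate[OF e2, of 0 a]
    proof (rule mean_bounded_compose[OF fst(1) open_slices(1)[OF \<Omega>] fst(2) K(1) nonneg])
      show "mono_on {0..} (\<lambda>t. \<phi> (t / (2 * K\<^sub>2)))"
        using K by (intro mono_onI mono_onD[OF \<phi>(1)]) (auto simp: divide_right_mono)
      show "2 * \<phi> (t / (2 * K\<^sub>2)) \<le> \<phi> (A * t / (2 * K\<^sub>2))" if "0 \<le> t" for t
        using growth[of "t / (2 * K\<^sub>2)"] K that by simp
      show "cball a (e / 2) \<subseteq> {x. (x, b) \<in> \<Omega>}"
        using sub e(1,3) by (auto simp: subset_iff)
    qed (use K A e(1) \<phi>(2) in auto)
    moreover have "AE x in lebesgue. x \<in> ?A \<longrightarrow> ennreal (\<phi> (v (x, b) / (2 * K\<^sub>2)))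
        \<le> d * (\<integral>\<^sup>+y\<in>?B. ennreal (\<psi> (v (x, y))) \<partial>lebesgue)"
      using snd
    proof eventually_elim
      case (elim x)
      show ?case
      proof
        assume x: "x \<in> ?A"
        have slice: "cball b (e / 2) \<subseteq> {y. (x, y) \<in> \<Omega>}"
          using sub e(3) x by (auto simp: subset_iff)
        have "ennreal (\<phi> (v (x, b) / (2 * K\<^sub>2))) \<le> d * (\<integral>\<^sup>+y\<in>?B. ennreal (\<phi> (v (x, y))) \<partial>lebesgue)"
          unfolding d_def measure_ball_translate[OF e2, of 0 b]
          using mean_bounded_compose[OF conjunct1[OF elim] open_slices(2)[OF \<Omega>] conjunct2[OF elim] K(2) nonneg
              \<phi>(1,2) growth A e2 slice] .
        also have "\<dots> \<le> d * (\<integral>\<^sup>+y\<in>?B. ennreal (\<psi> (v (x, y))) \<partial>lebesgue)"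
          using \<phi>(3) nonneg by (intro mult_left_mono nn_integral_mono mult_right_mono ennreal_leI) auto
        finally show "ennreal (\<phi> (v (x, b) / (2 * K\<^sub>2)))
            \<le> d * (\<integral>\<^sup>+y\<in>?B. ennreal (\<psi> (v (x, y))) \<partial>lebesgue)" .
      qed
    qed
    moreover have "(\<lambda>z. ennreal (\<psi> (v z))) \<in> borel_measurable (lebesgue_on (?A \<times> ?B))"
      using locally_integrable_measurable[OF \<psi>(3) e(2,3) balls] by measurable
    moreover have "?A \<times> ?B \<in> sets lebesgue" by (simp add: open_Times)
    ultimately have "ennreal (\<phi> (v (a, b) / (2 * K\<^sub>1) / (2 * K\<^sub>2)))
        \<le> c * d * (\<integral>\<^sup>+z\<in>?A \<times> ?B. ennreal (\<psi> (v z)) \<partial>lebesgue)"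
      using iterated_mean_le[of "\<lambda>z. ennreal (\<psi> (v z))" ?A ?B _ c "\<lambda>x. ennreal (\<phi> (v (x, b) / (2 * K\<^sub>2)))" d]
      by blast
    also have "\<dots> \<le> I"
      unfolding I_def using balls by (intro mult_left_mono nn_integral_mono) (auto simp: indicator_def)
    finally show ?thesis by (simp add: mult_ac)
  qed
  obtain k where "enn2real I / \<phi> t\<^sub>0 < 2 ^ k" using real_arch_pow[of 2] by auto
  then have k: "enn2real I < 2 ^ k * \<phi> t\<^sub>0" using t0 by (simp add: field_simps)
  have "v z \<le> 4 * K\<^sub>1 * K\<^sub>2 * (A ^ k * t\<^sub>0)" if "z \<in> C" for z
  proof (rule ccontr)
    assume large: "\<not> v z \<le> 4 * K\<^sub>1 * K\<^sub>2 * (A ^ k * t\<^sub>0)"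
    obtain a b where z: "z = (a, b)" by force
    have le: "A ^ k * t\<^sub>0 \<le> v z / (4 * K\<^sub>1 * K\<^sub>2)" using large K by (simp add: field_simps)
    have nn: "0 \<le> A ^ k * t\<^sub>0" using A t0(1) by simp
    have "2 ^ k * \<phi> t\<^sub>0 \<le> \<phi> (A ^ k * t\<^sub>0)" using A t0(1) by (intro growth_pow growth) auto
    also have "\<dots> \<le> \<phi> (v z / (4 * K\<^sub>1 * K\<^sub>2))"
      using le nn by (intro mono_onD[OF \<phi>(1)]) auto
    also have "\<dots> \<le> enn2real I"
    proof -
      have "ennreal (\<phi> (v z / (4 * K\<^sub>1 * K\<^sub>2))) \<le> ennreal (enn2real I)"
        using bound that z fin by simp
      then show ?thesis by (simp add: ennreal_le_iff)
    qed
    finally show False using k by simp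
  qed
  then show ?thesis by blast
qed

text \<open>
  The product of the two balls of radius \<open>r / 2\<close> lies in the ball of radius \<open>r\<close>, so the two mean value
  inequalities can be used one after the other.
\<close>

lemma separately_mean_bounded_le:
  fixes v :: "'a::euclidean_space \<times> 'b::euclidean_space \<Rightarrow> real"
  assumes r: "0 < r" "cball (a, b) r \<subseteq> \<Omega>" and v: "v \<in> borel_measurable (lebesgue_on \<Omega>)"
    and fst: "\<And>y. mean_bounded K\<^sub>1 (\<lambda>x. v (x, y)) {x. (x, y) \<in> \<Omega>}"
    and snd: "AE x in lebesgue. mean_bounded K\<^sub>2 (\<lambda>y. v (x, y)) {y. (x, y) \<in> \<Omega>}"
  shows "ennreal (v (a, b))
    \<le> ennreal (K\<^sub>1 / measure lebesgue (ball a (r / 2))) * ennreal (K\<^sub>2 / measure lebesgue (ball b (r / 2)))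
       * (\<integral>\<^sup>+z\<in>ball (a, b) r. ennreal (v z) \<partial>lebesgue)"
proof -
  let ?A = "ball a (r / 2)" and ?B = "ball b (r / 2)"
  let ?c = "ennreal (K\<^sub>1 / measure lebesgue ?A)" and ?d = "ennreal (K\<^sub>2 / measure lebesgue ?B)"
  have r2: "0 < r / 2" using r(1) by simp
  have sub: "cball a (r / 2) \<times> cball b (r / 2) \<subseteq> ball (a, b) r"
    by (rule cball_Times_half_subset_ball[OF r(1)])
  have balls: "?A \<times> ?B \<subseteq> ball (a, b) r"
    using sub by (meson Sigma_mono ball_subset_cball order.trans)
  have sub\<Omega>: "cball a (r / 2) \<times> cball b (r / 2) \<subseteq> \<Omega>"
    using sub r(2) ball_subset_cball by blast
  have "cball a (r / 2) \<subseteq> {x. (x, b) \<in> \<Omega>}"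
    using sub\<Omega> r(1) by (auto simp: subset_iff)
  then have "ennreal (v (a, b)) \<le> ?c * (\<integral>\<^sup>+x\<in>?A. ennreal (v (x, b)) \<partial>lebesgue)"
    using fst[of b] r2 unfolding mean_bounded_def by blast
  moreover have "AE x in lebesgue. x \<in> ?A \<longrightarrow> ennreal (v (x, b)) \<le> ?d * (\<integral>\<^sup>+y\<in>?B. ennreal (v (x, y)) \<partial>lebesgue)"
    using snd
  proof eventually_elim
    case (elim x)
    show ?case
    proof
      assume "x \<in> ?A"
      then have "cball b (r / 2) \<subseteq> {y. (x, y) \<in> \<Omega>}"
        using sub\<Omega> by (auto simp: subset_iff)
      then show "ennreal (v (x, b)) \<le> ?d * (\<integral>\<^sup>+y\<in>?B. ennreal (v (x, y)) \<partial>lebesgue)"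
        using elim r2 unfolding mean_bounded_def by blast
    qed
  qed
  moreover have "(\<lambda>z. ennreal (v z)) \<in> borel_measurable (lebesgue_on (?A \<times> ?B))"
  proof -
    have "?A \<times> ?B \<subseteq> \<Omega>" using balls r(2) ball_subset_cball by blast
    then have "v \<in> borel_measurable (lebesgue_on (?A \<times> ?B))"
      by (rule measurable_restrict_mono[OF v])
    then show ?thesis by measurable
  qed
  moreover have "?A \<times> ?B \<in> sets lebesgue" by (simp add: open_Times)
  ultimately have "ennreal (v (a, b)) \<le> ?c * ?d * (\<integral>\<^sup>+z\<in>?A \<times> ?B. ennreal (v z) \<partial>lebesgue)"
    using iterated_mean_le[of "\<lambda>z. ennreal (v z)" ?A ?B _ ?c "\<lambda>x. ennreal (v (x, b))" ?d] by blast
  also have "\<dots> \<le> ?c * ?d * (\<integral>\<^sup>+z\<in>ball (a, b) r. ennreal (v z) \<partial>lebesgue)"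
    using balls by (intro mult_left_mono nn_integral_mono) (auto simp: indicator_def)
  finally show ?thesis .
qed

section \<open>Separately quasi-nearly subharmonic functions\<close>

theorem proposition3:
  fixes \<Omega> :: "((real ^ 'm) \<times> (real ^ 'n)) set"
    and u :: "(real ^ 'm) \<times> (real ^ 'n) \<Rightarrow> ereal"
    and K\<^sub>1 K\<^sub>2 :: real
  assumes dims: "2 \<le> CARD('m)" "2 \<le> CARD('n)"
    and domain: "open \<Omega>" "connected \<Omega>"
    and K: "1 \<le> K\<^sub>1" "1 \<le> K\<^sub>2"
    and u_less_top: "\<forall>z\<in>\<Omega>. u z < \<infinity>"
    and u_measurable: "u \<in> borel_measurable (lebesgue_on \<Omega>)"
    and a: "\<forall>y. quasi_nearly_subharmonic_on K\<^sub>1 (\<lambda>x. u (x, y)) {x. (x, y) \<in> \<Omega>}"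
    and b: "AE x in lebesgue. quasi_nearly_subharmonic_on K\<^sub>2 (\<lambda>y. u (x, y)) {y. (x, y) \<in> \<Omega>}"
    and c: "\<exists>\<psi>. permissible \<psi> \<and> \<not> \<psi> constant_on {0..} \<and>
              (\<lambda>z. \<psi> (pos_part (u z))) locally_integrable_on \<Omega>"
  shows "quasi_nearly_subharmonic_on
           (4 ^ (CARD('m) + CARD('n)) * measure lebesgue (ball (0 :: (real ^ 'm) \<times> (real ^ 'n)) 1)
              * K\<^sub>1 * K\<^sub>2
            / (measure lebesgue (ball (0 :: real ^ 'm) 1) * measure lebesgue (ball (0 :: real ^ 'n) 1)))
           u \<Omega>"
proof -
  define \<nu>\<^sub>m where "\<nu>\<^sub>m = measure lebesgue (ball (0 :: real ^ 'm) 1)"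
  define \<nu>\<^sub>n where "\<nu>\<^sub>n = measure lebesgue (ball (0 :: real ^ 'n) 1)"
  define \<nu> where "\<nu> = measure lebesgue (ball (0 :: (real ^ 'm) \<times> (real ^ 'n)) 1)"
  define N where "N = CARD('m) + CARD('n)"
  have pos: "0 < \<nu>\<^sub>m" "0 < \<nu>\<^sub>n" "0 < \<nu>"
    unfolding \<nu>\<^sub>m_def \<nu>\<^sub>n_def \<nu>_def by (rule measure_ball_pos, simp)+
  have mean_fst: "mean_bounded K\<^sub>1 (\<lambda>x. truncate_below M (u (x, y))) {x. (x, y) \<in> \<Omega>}" if "0 \<le> M" for M y
    using quasi_nearly_subharmonic_imp_mean_bounded a that by blast
  have mean_snd: "AE x in lebesgue. mean_bounded K\<^sub>2 (\<lambda>y. truncate_below M (u (x, y))) {y. (x, y) \<in> \<Omega>}" if "0 \<le> M" for M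
    using b by eventually_elim (rule quasi_nearly_subharmonic_imp_mean_bounded[OF _ that])
  obtain \<psi> where \<psi>: "permissible \<psi>" "\<not> \<psi> constant_on {0..}"
    "(\<lambda>z. \<psi> (pos_part (u z))) locally_integrable_on \<Omega>"
    using c by blast
  have bounded: "\<exists>S. \<forall>z\<in>C. pos_part (u z) \<le> S" if C: "compact C" "C \<subseteq> \<Omega>" for C
  proof -
    have fst: "mean_bounded K\<^sub>1 (\<lambda>x. pos_part (u (x, y))) {x. (x, y) \<in> \<Omega>}" for y
      using mean_fst[of 0 y] by (simp add: truncate_below_zero)
    have fst_int: "(\<lambda>x. pos_part (u (x, y))) locally_integrable_on {x. (x, y) \<in> \<Omega>}" for y
      using a unfolding quasi_nearly_subharmonic_on_def by blast
    have snd: "AE x in lebesgue. mean_bounded K\<^sub>2 (\<lambda>y. pos_part (u (x, y))) {y. (x, y) \<in> \<Omega>}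
      \<and> (\<lambda>y. pos_part (u (x, y))) locally_integrable_on {y. (x, y) \<in> \<Omega>}"
      using mean_snd[of 0, OF order.refl] b
      by eventually_elim (simp add: truncate_below_zero quasi_nearly_subharmonic_on_def)
    have K0: "0 < K\<^sub>1" "0 < K\<^sub>2" using K by auto
    show ?thesis
      by (rule separately_mean_bounded_locally_bounded[where v = "\<lambda>z. pos_part (u z)",
            OF domain(1) pos_part_nonneg K0 fst fst_int snd \<psi> C])
  qed
  have meas: "(\<lambda>z. truncate_below M (u z)) \<in> borel_measurable (lebesgue_on \<Omega>)" for M
    using u_measurable by (rule borel_measurable_truncate_below)
  have integrable: "(\<lambda>z. truncate_below M (u z)) absolutely_integrable_on C"
    if M: "0 \<le> M" and C: "compact C" "C \<subseteq> \<Omega>" for M C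
  proof -
    obtain S where S: "\<forall>z\<in>C. pos_part (u z) \<le> S" using bounded[OF C] by (rule exE)
    show ?thesis
    proof (rule measurable_bounded_by_integrable_imp_absolutely_integrable)
      show "(\<lambda>z. truncate_below M (u z)) \<in> borel_measurable (lebesgue_on C)"
        by (rule measurable_restrict_mono[OF meas C(2)])
      show "C \<in> sets lebesgue" by (rule fmeasurableD[OF lmeasurable_compact[OF C(1)]])
      show "(\<lambda>z. S + M) integrable_on C"
        by (rule integrable_on_const[OF lmeasurable_compact[OF C(1)]])
      show "norm (truncate_below M (u z)) \<le> S + M" if "z \<in> C" for z
        using bspec[OF S that] truncate_below_le[OF M, of "u z"] truncate_below_nonneg[OF M, of "u z"]
        by simp
    qed
  qed
  have "(\<lambda>z. pos_part (u z)) locally_integrable_on \<Omega>"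
    using integrable[of 0] unfolding locally_integrable_on_def by (simp add: truncate_below_zero)
  moreover have "1 \<le> 4 ^ N * \<nu> * K\<^sub>1 * K\<^sub>2 / (\<nu>\<^sub>m * \<nu>\<^sub>n)"
  proof -
    have "\<nu>\<^sub>m * (1 / 2) ^ CARD('m) * (\<nu>\<^sub>n * (1 / 2) ^ CARD('n)) \<le> \<nu>"
      using measure_ball_Times_le[of 1 "0 :: real ^ 'm" "0 :: real ^ 'n"]
      unfolding \<nu>_def \<nu>\<^sub>m_def \<nu>\<^sub>n_def zero_prod_def
      by (simp only: measure_ball_scale[of "1 / 2" "0 :: real ^ 'm" 0] measure_ball_scale[of "1 / 2" "0 :: real ^ 'n" 0]) simp
    then have "\<nu>\<^sub>m * \<nu>\<^sub>n \<le> 2 ^ N * \<nu>"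
      by (simp add: N_def power_add power_divide field_simps)
    also have "\<dots> \<le> 4 ^ N * \<nu>"
      using pos by (intro mult_right_mono power_mono) auto
    also have "\<dots> \<le> 4 ^ N * \<nu> * (K\<^sub>1 * K\<^sub>2)"
      using pos K mult_mono[of 1 K\<^sub>1 1 K\<^sub>2] by simp
    finally show ?thesis using pos by (simp add: mult.assoc)
  qed
  moreover have "truncate_below M (u z) \<le> 4 ^ N * \<nu> * K\<^sub>1 * K\<^sub>2 / (\<nu>\<^sub>m * \<nu>\<^sub>n) / (\<nu> * r ^ N)
      * (LINT w:ball z r|lebesgue. truncate_below M (u w))"
    if M: "0 \<le> M" and r: "0 < r" "cball z r \<subseteq> \<Omega>" for M z r
  proof -
    obtain x y where z: "z = (x, y)" by force
    define I where "I = (LINT w:ball z r|lebesgue. truncate_below M (u w))"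
    have "set_integrable lebesgue (ball z r) (\<lambda>w. truncate_below M (u w))"
      using integrable[OF M compact_cball r(2)] by (rule set_integrable_subset) auto
    then have "(\<integral>\<^sup>+w. ennreal (indicat_real (ball z r) w *\<^sub>R truncate_below M (u w)) \<partial>lebesgue) = ennreal I"
      unfolding I_def set_lebesgue_integral_def set_integrable_def
      using truncate_below_nonneg[OF M] by (intro nn_integral_eq_integral) auto
    moreover have "(\<integral>\<^sup>+w. ennreal (indicat_real (ball z r) w *\<^sub>R truncate_below M (u w)) \<partial>lebesgue)
        = (\<integral>\<^sup>+w\<in>ball z r. ennreal (truncate_below M (u w)) \<partial>lebesgue)"
      by (intro nn_integral_cong) (auto simp: indicator_def)
    ultimately have I: "(\<integral>\<^sup>+w\<in>ball z r. ennreal (truncate_below M (u w)) \<partial>lebesgue) = ennreal I"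
      by simp
    have I0: "0 \<le> I"
      unfolding I_def set_lebesgue_integral_def
      using truncate_below_nonneg[OF M] by (intro integral_nonneg_AE) auto
    have vol: "measure lebesgue (ball x (r / 2)) = \<nu>\<^sub>m * (r / 2) ^ CARD('m)"
      "measure lebesgue (ball y (r / 2)) = \<nu>\<^sub>n * (r / 2) ^ CARD('n)"
      using measure_ball_scale[of "r / 2" x 0] measure_ball_scale[of "r / 2" y 0] r(1)
      unfolding \<nu>\<^sub>m_def \<nu>\<^sub>n_def by simp_all
    have nonneg: "0 \<le> K\<^sub>1 / (\<nu>\<^sub>m * (r / 2) ^ CARD('m))" "0 \<le> K\<^sub>2 / (\<nu>\<^sub>n * (r / 2) ^ CARD('n))"
      using pos K r(1) by simp_all
    have "ennreal (truncate_below M (u z))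
        \<le> ennreal (K\<^sub>1 / (\<nu>\<^sub>m * (r / 2) ^ CARD('m))) * ennreal (K\<^sub>2 / (\<nu>\<^sub>n * (r / 2) ^ CARD('n))) * ennreal I"
      using separately_mean_bounded_le[OF r(1) r(2)[unfolded z] meas mean_fst[OF M] mean_snd[OF M]]
      unfolding vol I[unfolded z] z .
    also have "\<dots> = ennreal (K\<^sub>1 / (\<nu>\<^sub>m * (r / 2) ^ CARD('m)) * (K\<^sub>2 / (\<nu>\<^sub>n * (r / 2) ^ CARD('n))) * I)"
      by (simp only: ennreal_mult[symmetric] nonneg I0 mult_nonneg_nonneg)
    finally have "truncate_below M (u z)
        \<le> K\<^sub>1 / (\<nu>\<^sub>m * (r / 2) ^ CARD('m)) * (K\<^sub>2 / (\<nu>\<^sub>n * (r / 2) ^ CARD('n))) * I"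
      by (simp only: ennreal_le_iff nonneg I0 mult_nonneg_nonneg)
    also have "\<dots> = 2 ^ N * \<nu> * K\<^sub>1 * K\<^sub>2 / (\<nu>\<^sub>m * \<nu>\<^sub>n) / (\<nu> * r ^ N) * I"
      using pos r(1) by (simp add: N_def power_add power_divide field_simps)
    \<comment> \<open>Radius \<open>r / 2\<close> costs only \<open>2 ^ N\<close>, so the constant with \<open>4 ^ N\<close> is not sharp.\<close>
    also have "\<dots> \<le> 4 ^ N * \<nu> * K\<^sub>1 * K\<^sub>2 / (\<nu>\<^sub>m * \<nu>\<^sub>n) / (\<nu> * r ^ N) * I"
      using pos K r(1) I0 by (intro mult_right_mono divide_right_mono power_mono) auto
    finally show ?thesis unfolding I_def .
  qed
  ultimately show ?thesis
    using dims domain(1) u_less_top u_measurable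
    unfolding quasi_nearly_subharmonic_on_def \<nu>\<^sub>m_def[symmetric] \<nu>\<^sub>n_def[symmetric] \<nu>_def[symmetric] N_def
    by simp
qed

end
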